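(* Let $\mathbf{k}$ be a field and let $i,j$ be integers with $i+2\le j\le 2i+2$. The class of graphs $G$ with $\beta_{i,j}(I_G)=0$ is $\chi$-bounded by $g_{j,j-i-2}(\omega)$, i.e. $\chi(G)\le g_{j,j-i-2}(\omega(G))$ for every such graph $G$.
   Context: $\chi(G)$ is the chromatic number and $\omega(G)$ the clique number. $\mathrm{Ind}(G)$ is the simplicial complex of independent sets of $G$; $I_G\subseteq \mathbf{k}[x_v\mid v\in V(G)]$ is generated by $x_ux_v$ for edges $uv$, and $\beta_{i,j}(I_G)=\sum_{W\subseteq V(G),|W|=j}\dim_{\mathbf{k}}\tilde H_{j-i-2}(\mathrm{Ind}(G[W]);\mathbf{k})$ (reduced simplicial homology, $G[W]$ the induced subgraph). For integers $d\ge 0$ and $n\ge 2(d+1)$ the function $g_{n,d}$ on positive integers is defined recursively by: $g_{n,d}(1)=1$; $g_{n,0}(\omega)=n-1$ for $\omega>1$; and for $d>0$, $\omega>1$, \[g_{n,d}(\omega)=\sum_{k=1}^{\omega}(\omega-k+1)\,g_{\max(n+k-\omega-2,\,2d),\,d-1}(k).\] *)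

theory Defs
  imports Complex_Main "HOL-Library.Poly_Mapping"
begin

section \<open>Finite simple graphs\<close>

text \<open>A graph is given by its vertex set \<open>V\<close> and its set \<open>E\<close> of two-element edges.\<close>

definition simple_graph :: "'a set \<Rightarrow> 'a set set \<Rightarrow> bool" where
  "simple_graph V E \<longleftrightarrow> finite V \<and> (\<forall>e\<in>E. e \<subseteq> V \<and> card e = 2)"

definition induced_edges :: "'a set set \<Rightarrow> 'a set \<Rightarrow> 'a set set" where
  "induced_edges E W = {e \<in> E. e \<subseteq> W}"

definition proper_coloring :: "'a set \<Rightarrow> 'a set set \<Rightarrow> nat \<Rightarrow> ('a \<Rightarrow> nat) \<Rightarrow> bool" where
  "proper_coloring V E k c \<longleftrightarrow>
     (\<forall>v\<in>V. c v < k) \<and> (\<forall>u\<in>V. \<forall>v\<in>V. {u, v} \<in> E \<longrightarrow> c u \<noteq> c v)"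

definition chromatic_number :: "'a set \<Rightarrow> 'a set set \<Rightarrow> nat" where
  "chromatic_number V E = (LEAST k. \<exists>c. proper_coloring V E k c)"

definition clique :: "'a set \<Rightarrow> 'a set set \<Rightarrow> 'a set \<Rightarrow> bool" where
  "clique V E C \<longleftrightarrow> C \<subseteq> V \<and> (\<forall>u\<in>C. \<forall>v\<in>C. u \<noteq> v \<longrightarrow> {u, v} \<in> E)"

definition clique_number :: "'a set \<Rightarrow> 'a set set \<Rightarrow> nat" where
  "clique_number V E = Max {card C | C. clique V E C}"

definition independence_complex :: "'a set \<Rightarrow> 'a set set \<Rightarrow> 'a set set" where
  "independence_complex V E = {S. S \<subseteq> V \<and> (\<forall>u\<in>S. \<forall>v\<in>S. {u, v} \<notin> E)}"

section \<open>Reduced simplicial homology over a field\<close>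

text \<open>
  Simplices are oriented by one linear order on the whole vertex type, chosen once and for all;
  up to isomorphism, the homology does not depend on it.
\<close>

definition vertex_order :: "('a \<times> 'a) set" where
  "vertex_order = (SOME r. linear_order_on UNIV r)"

lemma linear_order_vertex_order: "linear_order_on (UNIV :: 'a set) vertex_order"
proof -
  obtain r :: "'a rel" where "well_order_on UNIV r"
    using well_order_on by blast
  then have "linear_order_on UNIV r"
    by (simp add: well_order_on_def)
  then show ?thesis
    unfolding vertex_order_def by (rule someI)
qed

definition vertex_position :: "'a set \<Rightarrow> 'a \<Rightarrow> nat" where
  "vertex_position S v = card {u \<in> S. u \<noteq> v \<and> (u, v) \<in> vertex_order}"

definition chain_scale :: "'k::field \<Rightarrow> ('b \<Rightarrow>\<^sub>0 'k) \<Rightarrow> ('b \<Rightarrow>\<^sub>0 'k)" where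
  "chain_scale a c = Poly_Mapping.map ((*) a) c"

lemma lookup_chain_scale [simp]: "Poly_Mapping.lookup (chain_scale a c) s = a * Poly_Mapping.lookup c s"
  by (simp add: chain_scale_def Poly_Mapping.map.rep_eq when_def)

global_interpretation chain: vector_space "chain_scale :: 'k::field \<Rightarrow> ('b \<Rightarrow>\<^sub>0 'k) \<Rightarrow> ('b \<Rightarrow>\<^sub>0 'k)"
  by standard (auto intro!: poly_mapping_eqI simp: lookup_add algebra_simps)

text \<open>
  The empty face has dimension \<open>-1\<close>, which makes the chain complex the augmented one.
\<close>

definition chains :: "'a set set \<Rightarrow> int \<Rightarrow> ('a set \<Rightarrow>\<^sub>0 'k::field) set" where
  "chains K p = {c. \<forall>S\<in>Poly_Mapping.keys c. S \<in> K \<and> int (card S) = p + 1}"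

definition simplex_boundary :: "'a set \<Rightarrow> ('a set \<Rightarrow>\<^sub>0 'k::field)" where
  "simplex_boundary S =
     (\<Sum>v\<in>S. Poly_Mapping.single (S - {v}) ((- 1) ^ vertex_position S v))"

definition boundary :: "('a set \<Rightarrow>\<^sub>0 'k::field) \<Rightarrow> ('a set \<Rightarrow>\<^sub>0 'k)" where
  "boundary c = (\<Sum>S\<in>Poly_Mapping.keys c. chain_scale (Poly_Mapping.lookup c S) (simplex_boundary S))"

definition cycles :: "'a set set \<Rightarrow> int \<Rightarrow> ('a set \<Rightarrow>\<^sub>0 'k::field) set" where
  "cycles K p = {c \<in> chains K p. boundary c = 0}"

definition boundaries :: "'a set set \<Rightarrow> int \<Rightarrow> ('a set \<Rightarrow>\<^sub>0 'k::field) set" where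
  "boundaries K p = boundary ` chains K (p + 1)"

text \<open>
  For a finite simplicial complex \<open>K\<close> the boundaries form a subspace of the finite-dimensional
  space of cycles (see \<open>boundaries_subset_cycles\<close> below), so that the difference is the dimension
  of the quotient and the subtraction does not truncate.
\<close>

definition reduced_homology_dim :: "'k::field itself \<Rightarrow> 'a set set \<Rightarrow> int \<Rightarrow> nat" where
  "reduced_homology_dim _ K p =
     chain.dim (cycles K p :: ('a set \<Rightarrow>\<^sub>0 'k) set) -
     chain.dim (boundaries K p :: ('a set \<Rightarrow>\<^sub>0 'k) set)"

lemma boundary_superset:
  assumes "finite A" "Poly_Mapping.keys c \<subseteq> A"
  shows "boundary c = (\<Sum>S\<in>A. chain_scale (Poly_Mapping.lookup c S) (simplex_boundary S))"
  unfolding boundary_def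
  by (rule sum.mono_neutral_left) (use assms in \<open>auto simp: in_keys_iff\<close>)

lemma boundary_add: "boundary (c + d) = boundary c + boundary d"
proof -
  let ?A = "Poly_Mapping.keys c \<union> Poly_Mapping.keys d"
  have "Poly_Mapping.keys (c + d) \<subseteq> ?A"
    by (rule keys_add)
  then show ?thesis
    by (simp add: boundary_superset[of ?A] lookup_add chain.scale_left_distrib sum.distrib)
qed

lemma boundary_scale: "boundary (chain_scale a c) = chain_scale a (boundary c)"
proof -
  have "Poly_Mapping.keys (chain_scale a c) \<subseteq> Poly_Mapping.keys c"
    by (auto simp: in_keys_iff)
  then show ?thesis
    by (simp add: boundary_superset[of "Poly_Mapping.keys c"] chain.scale_sum_right)
qed

lemma boundary_sum: "boundary (\<Sum>i\<in>I. f i) = (\<Sum>i\<in>I. boundary (f i))"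
  by (induction I rule: infinite_finite_induct)
     (simp_all add: boundary_add boundary_def[of 0])

lemma boundary_single: "boundary (Poly_Mapping.single S a) = chain_scale a (simplex_boundary S)"
  by (cases "a = 0") (simp_all add: boundary_def)

lemma vertex_position_Diff:
  assumes "finite S" "u \<in> S" "v \<in> S" "u \<noteq> v" "(u, v) \<in> vertex_order"
  shows "vertex_position S v = Suc (vertex_position (S - {u}) v)"
    and "vertex_position (S - {v}) u = vertex_position S u"
proof -
  have "{w \<in> S. w \<noteq> v \<and> (w, v) \<in> vertex_order} =
        insert u {w \<in> S - {u}. w \<noteq> v \<and> (w, v) \<in> vertex_order}"
    using assms by auto
  then show "vertex_position S v = Suc (vertex_position (S - {u}) v)"
    using assms(1) by (simp add: vertex_position_def)
  have "(v, u) \<notin> vertex_order"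
    using assms(4,5) linear_order_vertex_order
    by (metis antisymD linear_order_on_def partial_order_on_def)
  then have "{w \<in> S - {v}. w \<noteq> u \<and> (w, u) \<in> vertex_order} =
             {w \<in> S. w \<noteq> u \<and> (w, u) \<in> vertex_order}"
    by auto
  then show "vertex_position (S - {v}) u = vertex_position S u"
    by (simp add: vertex_position_def)
qed

lemma boundary_simplex_boundary: "boundary (simplex_boundary S :: 'a set \<Rightarrow>\<^sub>0 'k::field) = 0"
proof (cases "finite S")
  case False
  then show ?thesis
    by (simp add: simplex_boundary_def boundary_def)
next
  case True
  define f :: "'a \<times> 'a \<Rightarrow> 'a set \<Rightarrow>\<^sub>0 'k" where
    "f = (\<lambda>(v, u). Poly_Mapping.single (S - {v} - {u})
            ((- 1) ^ vertex_position S v * (- 1) ^ vertex_position (S - {v}) u))"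
  define P where "P = {(v, u). v \<in> S \<and> u \<in> S \<and> u \<noteq> v \<and> (u, v) \<in> vertex_order}"
  define Q where "Q = {(v, u). v \<in> S \<and> u \<in> S \<and> u \<noteq> v \<and> (v, u) \<in> vertex_order}"
  have scale_single: "chain_scale a (Poly_Mapping.single T b) = Poly_Mapping.single T (a * b)"
    for a b :: 'k and T :: "'a set"
    by (rule poly_mapping_eqI) (simp add: lookup_single when_def)
  have fin: "finite P" "finite Q"
    by (rule finite_subset[of _ "S \<times> S"]; use True in \<open>auto simp: P_def Q_def\<close>)+
  have "boundary (simplex_boundary S :: 'a set \<Rightarrow>\<^sub>0 'k) = (\<Sum>v\<in>S. \<Sum>u\<in>S - {v}. f (v, u))"
    unfolding simplex_boundary_def[of S] boundary_sum boundary_single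
    by (simp add: simplex_boundary_def chain.scale_sum_right scale_single f_def)
  also have "\<dots> = (\<Sum>x\<in>Sigma S (\<lambda>v. S - {v}). f x)"
    using True by (simp add: sum.Sigma)
  also have "Sigma S (\<lambda>v. S - {v}) = P \<union> Q"
    using linear_order_vertex_order
    by (auto simp: P_def Q_def linear_order_on_def total_on_def)
  also have "(\<Sum>x\<in>P \<union> Q. f x) = (\<Sum>x\<in>P. f x) + (\<Sum>x\<in>Q. f x)"
  proof (rule sum.union_disjoint[OF fin])
    show "P \<inter> Q = {}"
      using linear_order_vertex_order
      by (auto simp: P_def Q_def linear_order_on_def partial_order_on_def dest: antisymD)
  qed
  also have "(\<Sum>x\<in>Q. f x) = (\<Sum>x\<in>P. f (prod.swap x))"
    by (rule sum.reindex_bij_witness[of _ prod.swap prod.swap]) (auto simp: P_def Q_def)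
  also have "\<dots> = (\<Sum>x\<in>P. - f x)"
  proof (rule sum.cong)
    fix x assume "x \<in> P"
    then obtain v u where x: "x = (v, u)" "v \<in> S" "u \<in> S" "u \<noteq> v" "(u, v) \<in> vertex_order"
      by (auto simp: P_def)
    have "S - {u} - {v} = S - {v} - {u}"
      by auto
    then show "f (prod.swap x) = - f x"
      using vertex_position_Diff[OF True x(3,2,4,5)]
      by (simp add: x(1) f_def single_uminus mult.commute)
  qed simp
  finally show ?thesis
    by (simp add: sum_negf)
qed

lemma boundary_boundary: "boundary (boundary c) = 0"
  by (simp add: boundary_def[of c] boundary_sum boundary_scale boundary_simplex_boundary)

lemma boundaries_subset_cycles:
  assumes "\<And>S T. S \<in> K \<Longrightarrow> T \<subseteq> S \<Longrightarrow> T \<in> K"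
  shows "boundaries K p \<subseteq> cycles K p"
proof
  fix d :: "'a set \<Rightarrow>\<^sub>0 'k::field"
  assume "d \<in> boundaries K p"
  then obtain c where c: "c \<in> chains K (p + 1)" "d = boundary c"
    by (auto simp: boundaries_def)
  have "T \<in> K \<and> int (card T) = p + 1" if "T \<in> Poly_Mapping.keys d" for T
  proof -
    have "Poly_Mapping.lookup d T \<noteq> 0"
      using that by (simp add: in_keys_iff)
    then obtain S where S: "S \<in> Poly_Mapping.keys c" "Poly_Mapping.lookup (simplex_boundary S :: 'a set \<Rightarrow>\<^sub>0 'k) T \<noteq> 0"
      by (auto simp: c(2) boundary_def lookup_sum elim!: sum.not_neutral_contains_not_neutral)
    then obtain v where v: "v \<in> S" "T = S - {v}"
      by (auto simp: simplex_boundary_def lookup_sum lookup_single when_def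
               elim!: sum.not_neutral_contains_not_neutral split: if_splits)
    have "finite S"
      using S(2) by (auto simp: simplex_boundary_def intro: ccontr)
    moreover have "S \<in> K" "int (card S) = p + 2"
      using c(1) S(1) by (auto simp: chains_def)
    ultimately show ?thesis
      using v assms[of S T] card_Suc_Diff1[of S v] by auto
  qed
  then show "d \<in> cycles K p"
    by (auto simp: cycles_def chains_def c(2) boundary_boundary)
qed

section \<open>Graded Betti numbers of the edge ideal\<close>

text \<open>
  The graded Betti numbers \<open>\<beta>\<^sub>i\<^sub>,\<^sub>j(I\<^sub>G)\<close> over the field \<open>'k\<close>, as given by Hochster's formula.
\<close>

definition edge_ideal_betti :: "'k::field itself \<Rightarrow> 'a set \<Rightarrow> 'a set set \<Rightarrow> int \<Rightarrow> int \<Rightarrow> nat" where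
  "edge_ideal_betti k V E i j =
     (\<Sum>W | W \<subseteq> V \<and> int (card W) = j.
        reduced_homology_dim k (independence_complex W (induced_edges E W)) (j - i - 2))"

section \<open>The bounding function\<close>

text \<open>
  \<open>chi_bound n d \<omega>\<close> is only meaningful for \<open>n \<ge> 2 * (d + 1)\<close> and \<open>\<omega> \<ge> 1\<close>. The first condition
  is preserved by the recursion; the first parameter is an integer because \<open>n + k - \<omega> - 2\<close> may be
  negative.
\<close>

fun chi_bound :: "int \<Rightarrow> nat \<Rightarrow> nat \<Rightarrow> int" where
  "chi_bound n 0 \<omega> = (if \<omega> = 1 then 1 else n - 1)"
| "chi_bound n (Suc d) \<omega> =
     (if \<omega> = 1 then 1
      else \<Sum>k = 1..\<omega>. (int \<omega> - int k + 1) *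
             chi_bound (max (n + int k - int \<omega> - 2) (2 * int (Suc d))) d k)"

end

(*
  Call G (n,d)-acyclic if the reduced homology of Ind(G[W]) vanishes in degree d for all W of size n.
  The bound goes by induction on d. If uv is an edge and W consists of common nonneighbours of u and
  v, then Ind(G[W + u + v]) is the suspension of Ind(G[W]), and adding neighbours of v to the vertex
  set does not make the suspension of a nontrivial class trivial. So an (n,d)-acyclic graph induces
  an (m,d-1)-acyclic one on the common nonneighbours of u and v, for any m <= n - 2 such that n - 2 - m
  further neighbours of v are available. Fix a maximum clique; the vertices with a single nonneighbour
  in it fall into omega independent sets, and the other ones are sorted by their first two
  nonneighbours u, v, so that the induction hypothesis applies to each class. For d = 0 the same
  argument with W empty bounds all degrees by n - 2, and greedy colouring applies.
*)

theory Submission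
  imports Defs
begin

section \<open>Acyclicity\<close>

text \<open>Stated as an inclusion of chain sets, so that the suspension argument can work with
  explicit chains instead of dimensions.\<close>

definition acyclic_at :: "'k::field itself \<Rightarrow> 'a set set \<Rightarrow> int \<Rightarrow> bool" where
  "acyclic_at _ K p \<longleftrightarrow> (cycles K p :: ('a set \<Rightarrow>\<^sub>0 'k) set) \<subseteq> boundaries K p"

lemma subspace_chains: "chain.subspace (chains K p)"
  unfolding chain.subspace_def chains_def
  using keys_add by (fastforce simp: in_keys_iff)

lemma subspace_boundaries: "chain.subspace (boundaries K p :: ('a set \<Rightarrow>\<^sub>0 'k::field) set)"
  unfolding chain.subspace_def boundaries_def
proof (intro conjI ballI allI)
  have ch: "chain.subspace (chains K (p + 1) :: ('a set \<Rightarrow>\<^sub>0 'k) set)"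
    by (rule subspace_chains)
  show "(0 :: 'a set \<Rightarrow>\<^sub>0 'k) \<in> boundary ` chains K (p + 1)"
    using chain.subspace_0[OF ch] by (force simp: boundary_def)
  fix x y :: "'a set \<Rightarrow>\<^sub>0 'k"
  assume "x \<in> boundary ` chains K (p + 1)" "y \<in> boundary ` chains K (p + 1)"
  then show "x + y \<in> boundary ` chains K (p + 1)"
    by (auto simp flip: boundary_add intro!: imageI chain.subspace_add[OF ch])
next
  fix a :: 'k and x :: "'a set \<Rightarrow>\<^sub>0 'k"
  assume "x \<in> boundary ` chains K (p + 1)"
  then show "chain_scale a x \<in> boundary ` chains K (p + 1)"
    by (auto simp flip: boundary_scale intro!: imageI chain.subspace_scale[OF subspace_chains])
qed

section \<open>Linear maps on chains, given by their values on faces\<close>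

definition linear_extension :: "('b \<Rightarrow> ('c \<Rightarrow>\<^sub>0 'k)) \<Rightarrow> ('b \<Rightarrow>\<^sub>0 'k::field) \<Rightarrow> ('c \<Rightarrow>\<^sub>0 'k)" where
  "linear_extension f c =
     (\<Sum>S\<in>Poly_Mapping.keys c. chain_scale (Poly_Mapping.lookup c S) (f S))"

lemma boundary_eq_linear_extension: "boundary = linear_extension simplex_boundary"
  by (simp add: fun_eq_iff boundary_def linear_extension_def)

lemma linear_extension_superset:
  assumes "finite A" "Poly_Mapping.keys c \<subseteq> A"
  shows "linear_extension f c = (\<Sum>S\<in>A. chain_scale (Poly_Mapping.lookup c S) (f S))"
  unfolding linear_extension_def
  by (rule sum.mono_neutral_left) (use assms in \<open>auto simp: in_keys_iff\<close>)

lemma linear_extension_0 [simp]: "linear_extension f 0 = 0"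
  by (simp add: linear_extension_def)

lemma linear_extension_add:
  "linear_extension f (c + d) = linear_extension f c + linear_extension f d"
proof -
  let ?A = "Poly_Mapping.keys c \<union> Poly_Mapping.keys d"
  have "Poly_Mapping.keys (c + d) \<subseteq> ?A"
    by (rule keys_add)
  then show ?thesis
    by (simp add: linear_extension_superset[of ?A] lookup_add chain.scale_left_distrib sum.distrib)
qed

lemma linear_extension_scale:
  "linear_extension f (chain_scale a c) = chain_scale a (linear_extension f c)"
proof -
  have "Poly_Mapping.keys (chain_scale a c) \<subseteq> Poly_Mapping.keys c"
    by (auto simp: in_keys_iff)
  then show ?thesis
    by (simp add: linear_extension_superset[of "Poly_Mapping.keys c"] chain.scale_sum_right)
qed

lemma linear_extension_uminus: "linear_extension f (- c) = - linear_extension f c"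
  using linear_extension_add[of f c "- c"] by (simp add: eq_neg_iff_add_eq_0 add.commute)

lemma linear_extension_diff:
  "linear_extension f (c - d) = linear_extension f c - linear_extension f d"
  using linear_extension_add[of f c "- d"] by (simp add: linear_extension_uminus)

lemma linear_extension_sum:
  "linear_extension f (\<Sum>i\<in>I. g i) = (\<Sum>i\<in>I. linear_extension f (g i))"
  by (induction I rule: infinite_finite_induct) (simp_all add: linear_extension_add)

lemma linear_extension_single:
  "linear_extension f (Poly_Mapping.single S a) = chain_scale a (f S)"
  by (cases "a = 0") (simp_all add: linear_extension_def)

lemma chain_scale_single:
  "chain_scale a (Poly_Mapping.single T b) = Poly_Mapping.single T (a * b)"
  by (rule poly_mapping_eqI) (simp add: lookup_single when_def)

text \<open>Reduces identities between composites of linear maps to identities on single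
  faces.\<close>

lemma linear_extension_comp:
  "linear_extension f (linear_extension g c) = linear_extension (\<lambda>S. linear_extension f (g S)) c"
  by (simp add: linear_extension_def[of g] linear_extension_sum linear_extension_scale
      linear_extension_def[of "\<lambda>S. linear_extension f (g S)"])

lemma linear_extension_cong:
  "(\<And>S. S \<in> Poly_Mapping.keys c \<Longrightarrow> f S = g S) \<Longrightarrow> linear_extension f c = linear_extension g c"
  by (simp add: linear_extension_def)

lemma linear_extension_diff_fun:
  "linear_extension (\<lambda>S. f S - g S) c = linear_extension f c - linear_extension g c"
  by (simp add: linear_extension_def chain.scale_right_diff_distrib sum_subtractf)

lemma linear_extension_uminus_fun: "linear_extension (\<lambda>S. - f S) c = - linear_extension f c"
  by (simp add: linear_extension_def sum_negf)

lemma linear_extension_ident: "linear_extension (\<lambda>S. Poly_Mapping.single S 1) c = c"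
  by (rule poly_mapping_eqI)
     (auto simp: linear_extension_def lookup_sum lookup_single when_def if_distrib in_keys_iff
           cong: if_cong)

lemma keys_linear_extensionE:
  assumes "T \<in> Poly_Mapping.keys (linear_extension f c)"
  obtains S where "S \<in> Poly_Mapping.keys c" "T \<in> Poly_Mapping.keys (f S)"
proof -
  from assms have "(\<Sum>S\<in>Poly_Mapping.keys c.
      Poly_Mapping.lookup (chain_scale (Poly_Mapping.lookup c S) (f S)) T) \<noteq> 0"
    by (simp add: linear_extension_def lookup_sum in_keys_iff)
  then show thesis
    by (rule sum.not_neutral_contains_not_neutral) (auto intro: that simp: in_keys_iff)
qed

text \<open>Extend a basis \<open>B\<close> of the boundaries to a basis \<open>Z\<close> of the
  cycles: if the dimensions agree, nothing was added, and the two spaces coincide.\<close>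

lemma acyclic_at_if_reduced_homology_dim_eq_0:
  assumes "finite K" "\<And>S T. S \<in> K \<Longrightarrow> T \<subseteq> S \<Longrightarrow> T \<in> K"
    and "reduced_homology_dim TYPE('k::field) K p = 0"
  shows "acyclic_at TYPE('k) K p"
proof -
  let ?Z = "cycles K p :: ('a set \<Rightarrow>\<^sub>0 'k) set" and ?B = "boundaries K p :: ('a set \<Rightarrow>\<^sub>0 'k) set"
  let ?T = "(\<lambda>S. Poly_Mapping.single S (1::'k)) ` K"
  have sub: "?B \<subseteq> ?Z"
    using assms(2) by (rule boundaries_subset_cycles)
  obtain B where B: "B \<subseteq> ?B" "chain.independent B" "?B \<subseteq> chain.span B" "card B = chain.dim ?B"
    using chain.basis_exists by blast
  obtain Z where Z: "B \<subseteq> Z" "Z \<subseteq> ?Z" "chain.independent Z" "?Z \<subseteq> chain.span Z"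
    using chain.maximal_independent_subset_extend[of B ?Z] B(1,2) sub by blast
  \<comment> \<open>The finitely many single faces span all cycles, which makes \<open>Z\<close>
    finite and cardinalities conclusive.\<close>
  have "?Z \<subseteq> chain.span ?T"
  proof
    fix c assume "c \<in> ?Z"
    then have keys: "Poly_Mapping.keys c \<subseteq> K"
      by (auto simp: cycles_def chains_def)
    have "linear_extension (\<lambda>S. Poly_Mapping.single S 1) c \<in> chain.span ?T"
      unfolding linear_extension_def
      using keys by (intro chain.span_sum chain.span_scale chain.span_base) auto
    then show "c \<in> chain.span ?T"
      by (simp add: linear_extension_ident)
  qed
  then have "finite Z"
    using chain.independent_span_bound[of ?T Z] Z(2,3) assms(1) by auto
  have "chain.dim ?Z = card Z"
    using chain.dim_unique Z by blast
  \<comment> \<open>The subtraction of naturals truncates, so a zero difference yields only this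
    inequality.\<close>
  then have "card Z \<le> card B"
    using assms(3) B(4) by (simp add: reduced_homology_dim_def)
  then have "Z = B"
    using card_seteq[OF \<open>finite Z\<close> Z(1)] by simp
  moreover have "chain.span B \<subseteq> ?B"
    using B(1) subspace_boundaries by (rule chain.span_minimal)
  ultimately show ?thesis
    using Z(4) by (auto simp: acyclic_at_def)
qed

section \<open>Suspensions\<close>

text \<open>The join with \<open>v\<close> as first vertex; the sign moves \<open>v\<close> to its
  place in \<open>vertex_order\<close>. Meant for faces without \<open>v\<close>.\<close>

definition cone :: "'a \<Rightarrow> 'a set \<Rightarrow> ('a set \<Rightarrow>\<^sub>0 'k::field)" where
  "cone v S = Poly_Mapping.single (insert v S) ((- 1) ^ vertex_position S v)"

text \<open>The summand of \<open>simplex_boundary\<close> that drops \<open>v\<close>; it takes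
  chains to chains of the link of \<open>v\<close>.\<close>

definition contract :: "'a \<Rightarrow> 'a set \<Rightarrow> ('a set \<Rightarrow>\<^sub>0 'k::field)" where
  "contract v S =
     (if v \<in> S then Poly_Mapping.single (S - {v}) ((- 1) ^ vertex_position S v) else 0)"

lemma vertex_position_insert [simp]: "vertex_position (insert v S) v = vertex_position S v"
  unfolding vertex_position_def by (rule arg_cong[where f = card]) auto

text \<open>Removing the smaller of two vertices shifts the larger by one position, while removing
  the larger leaves the smaller in place.\<close>

lemma vertex_position_sign:
  assumes "finite S" "u \<in> S" "v \<in> S" "u \<noteq> v"
  shows "((- 1) ^ vertex_position S u * (- 1) ^ vertex_position (S - {u}) v :: 'k::field) =
    - ((- 1) ^ vertex_position S v * (- 1) ^ vertex_position (S - {v}) u)"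
proof -
  have "(u, v) \<in> vertex_order \<or> (v, u) \<in> vertex_order"
    using linear_order_vertex_order assms(4) by (auto simp: linear_order_on_def total_on_def)
  then show ?thesis
    using vertex_position_Diff[OF assms] vertex_position_Diff[of S v u] assms by auto
qed

text \<open>Dropping \<open>v\<close> and another vertex in the two possible orders gives opposite
  signs. For infinite \<open>S\<close> both sides are 0.\<close>

lemma contract_simplex_boundary:
  "linear_extension (contract v) (simplex_boundary S) =
     - (boundary (contract v S) :: 'a set \<Rightarrow>\<^sub>0 'k::field)"
proof (cases "finite S")
  case False
  then show ?thesis
    by (simp add: simplex_boundary_def contract_def boundary_single boundary_def[of 0])
next
  case fin: True
  have *: "linear_extension (contract v) (simplex_boundary S) =
    (\<Sum>u\<in>S. chain_scale ((- 1) ^ vertex_position S u) (contract v (S - {u}) :: 'a set \<Rightarrow>\<^sub>0 'k))"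
    by (simp add: simplex_boundary_def linear_extension_sum linear_extension_single)
  show ?thesis
  proof (cases "v \<in> S")
    case False
    then show ?thesis
      unfolding * by (simp add: contract_def boundary_def[of 0])
  next
    case True
    have "(\<Sum>u\<in>S. chain_scale ((- 1) ^ vertex_position S u) (contract v (S - {u}) :: 'a set \<Rightarrow>\<^sub>0 'k)) =
      (\<Sum>u\<in>S - {v}. chain_scale ((- 1) ^ vertex_position S u) (contract v (S - {u})))"
      using fin by (intro sum.mono_neutral_right) (auto simp: contract_def)
    also have "\<dots> = (\<Sum>u\<in>S - {v}. - chain_scale ((- 1) ^ vertex_position S v)
        (Poly_Mapping.single (S - {v} - {u}) ((- 1) ^ vertex_position (S - {v}) u)))"
    proof (rule sum.cong)
      fix u assume u: "u \<in> S - {v}"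
      have "S - {u} - {v} = S - {v} - {u}"
        by auto
      then show "chain_scale ((- 1) ^ vertex_position S u) (contract v (S - {u})) =
        - chain_scale ((- 1) ^ vertex_position S v)
          (Poly_Mapping.single (S - {v} - {u}) ((- 1) ^ vertex_position (S - {v}) u) :: 'a set \<Rightarrow>\<^sub>0 'k)"
        using u vertex_position_sign[of S u v, where 'k = 'k] fin True
        by (auto simp: contract_def chain_scale_single single_uminus[symmetric])
    qed simp
    also have "\<dots> = - boundary (contract v S)"
      using True
      by (simp add: contract_def boundary_single simplex_boundary_def chain.scale_sum_right sum_negf)
    finally show ?thesis
      unfolding * .
  qed
qed

text \<open>Dropping the apex returns \<open>S\<close>, as its sign occurs twice; dropping another
  vertex gives the cone over a facet with reversed sign, as the apex counts as first vertex.\<close>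

lemma boundary_cone:
  assumes "finite S" "v \<notin> S"
  shows "boundary (cone v S) =
    Poly_Mapping.single S 1 - (linear_extension (cone v) (simplex_boundary S) :: 'a set \<Rightarrow>\<^sub>0 'k::field)"
proof -
  let ?s = "\<lambda>S u. (- 1) ^ vertex_position S u :: 'k"
  have "boundary (cone v S) =
    chain_scale (?s S v) (Poly_Mapping.single S (?s S v)) +
    (\<Sum>u\<in>S. chain_scale (?s S v) (Poly_Mapping.single (insert v S - {u}) (?s (insert v S) u)))"
    using assms
    by (simp add: cone_def boundary_single simplex_boundary_def chain.scale_sum_right
        chain.scale_right_distrib)
  also have "chain_scale (?s S v) (Poly_Mapping.single S (?s S v)) = Poly_Mapping.single S 1"
    by (simp add: chain_scale_single flip: power_add mult_2)
  also have "(\<Sum>u\<in>S. chain_scale (?s S v) (Poly_Mapping.single (insert v S - {u}) (?s (insert v S) u))) =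
    (\<Sum>u\<in>S. - chain_scale (?s S u) (cone v (S - {u})))"
  proof (rule sum.cong)
    fix u assume u: "u \<in> S"
    then have ne: "u \<noteq> v"
      using assms by auto
    then have "insert v S - {u} = insert v (S - {u})"
      by auto
    have sign: "?s (insert v S) u * ?s (S - {u}) v = - (?s S v * ?s S u)"
      using vertex_position_sign[of "insert v S" u v, where 'k = 'k] u ne assms
      by (simp add: insert_Diff_if)
    have sq: "?s T w * ?s T w = 1" for T w
      by (simp flip: power_add mult_2)
    \<comment> \<open>The sign \<open>?s (S - {u}) v\<close>, whose square is 1, is inserted twice
      so that \<open>sign\<close> applies.\<close>
    have "?s S v * ?s (insert v S) u =
        ?s S v * (?s (insert v S) u * ?s (S - {u}) v) * ?s (S - {u}) v"
      by (simp add: mult.assoc sq)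
    also have "\<dots> = - ((?s S v * ?s S v) * (?s S u * ?s (S - {u}) v))"
      unfolding sign by (simp add: mult_ac)
    also have "?s S v * ?s S v = 1"
      by (rule sq)
    finally show "chain_scale (?s S v) (Poly_Mapping.single (insert v S - {u}) (?s (insert v S) u)) =
      - chain_scale (?s S u) (cone v (S - {u}))"
      using \<open>insert v S - {u} = _\<close>
      by (simp add: cone_def chain_scale_single single_uminus[symmetric])
  qed simp
  finally show ?thesis
    by (simp add: simplex_boundary_def linear_extension_sum linear_extension_single sum_negf)
qed

lemma contract_cone:
  assumes "v \<notin> S"
  shows "linear_extension (contract v) (cone v S) = (Poly_Mapping.single S 1 :: 'a set \<Rightarrow>\<^sub>0 'k::field)"
  using assms
  by (simp add: cone_def contract_def linear_extension_single chain_scale_single flip: power_add mult_2)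

lemma contract_cone_other:
  assumes "v \<notin> S" "u \<noteq> v"
  shows "linear_extension (contract v) (cone u S) = (0 :: 'a set \<Rightarrow>\<^sub>0 'k::field)"
  using assms by (simp add: cone_def contract_def linear_extension_single)

text \<open>By \<open>boundary_cone\<close>, the correction term is the cone over
  \<open>boundary z\<close>, which vanishes.\<close>

lemma boundary_linear_extension_cone:
  fixes z :: "'a set \<Rightarrow>\<^sub>0 'k::field"
  assumes "boundary z = 0" "\<And>S. S \<in> Poly_Mapping.keys z \<Longrightarrow> finite S \<and> v \<notin> S"
  shows "boundary (linear_extension (cone v) z) = z"
proof -
  have "boundary (linear_extension (cone v) z) = linear_extension (\<lambda>S. boundary (cone v S)) z"
    by (simp add: boundary_eq_linear_extension linear_extension_comp)
  also have "\<dots> = linear_extension (\<lambda>S. Poly_Mapping.single S 1 -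
      linear_extension (cone v) (simplex_boundary S)) z"
    using assms(2) by (intro linear_extension_cong boundary_cone) auto
  also have "\<dots> = z - linear_extension (cone v) (boundary z)"
    by (simp add: linear_extension_diff_fun linear_extension_ident boundary_eq_linear_extension
        linear_extension_comp)
  finally show ?thesis
    using assms(1) by simp
qed

lemma contract_boundary:
  "linear_extension (contract v) (boundary c) = - boundary (linear_extension (contract v) c)"
proof -
  have "linear_extension (contract v) (boundary c) =
      linear_extension (\<lambda>S. - boundary (contract v S)) c"
    by (simp add: boundary_eq_linear_extension linear_extension_comp
        contract_simplex_boundary[unfolded boundary_eq_linear_extension])
  then show ?thesis
    by (simp add: boundary_eq_linear_extension linear_extension_comp linear_extension_uminus_fun)
qed

text \<open>
  The independence complex of \<open>W \<union> {u, v}\<close> is the suspension of that of \<open>W\<close>. Contracting by \<open>v\<close>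
  turns a chain bounding the suspension of a cycle into one bounding the cycle, and the vertices
  in \<open>C\<close> do not interfere because no independent set containing \<open>v\<close> meets \<open>C\<close>.
\<close>

lemma acyclic_at_suspension:
  assumes "finite W" and "{u, v} \<in> E" "u \<noteq> v"
    and "u \<notin> W" "v \<notin> W"
    and loops: "\<And>x. {x} \<notin> E"
    and nonadj: "\<And>x. x \<in> W \<Longrightarrow> {x, u} \<notin> E \<and> {x, v} \<notin> E"
    and adj: "\<And>x. x \<in> C \<Longrightarrow> {x, v} \<in> E"
    and acyc: "acyclic_at TYPE('k::field) (independence_complex (W \<union> C \<union> {u, v}) E) (p + 1)"
  shows "acyclic_at TYPE('k) (independence_complex W E) p"
  unfolding acyclic_at_def
proof
  let ?X = "independence_complex W E" and ?L = "independence_complex (W \<union> C \<union> {u, v}) E"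
  fix z :: "'a set \<Rightarrow>\<^sub>0 'k" assume "z \<in> cycles ?X p"
  then have bz: "boundary z = 0"
    by (simp add: cycles_def)
  have keys: "S \<in> ?X \<and> int (card S) = p + 1" if "S \<in> Poly_Mapping.keys z" for S
    using that \<open>z \<in> cycles ?X p\<close> by (auto simp: cycles_def chains_def)
  have sub: "S \<subseteq> W \<and> finite S \<and> u \<notin> S \<and> v \<notin> S" if "S \<in> Poly_Mapping.keys z" for S
    using keys[OF that] assms(1,4,5) by (auto simp: independence_complex_def intro: finite_subset)
  have cone_chain: "linear_extension (cone w) z \<in> chains ?L (p + 1)" if "w \<in> {u, v}" for w
    unfolding chains_def
  proof (intro CollectI ballI)
    fix T assume "T \<in> Poly_Mapping.keys (linear_extension (cone w) z)"
    then obtain S where S: "S \<in> Poly_Mapping.keys z" "T = insert w S"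
      by (rule keys_linear_extensionE) (auto simp: cone_def split: if_splits)
    have "{x, w} \<notin> E \<and> {w, x} \<notin> E" if "x \<in> S" for x
      using nonadj[of x] sub[OF S(1)] that \<open>w \<in> {u, v}\<close> by (auto simp: insert_commute)
    then show "T \<in> ?L \<and> int (card T) = p + 1 + 1"
      using keys[OF S(1)] sub[OF S(1)] \<open>w \<in> {u, v}\<close> loops S(2)
      by (auto simp: independence_complex_def)
  qed
  \<comment> \<open>The suspension of \<open>z\<close>: two cones over \<open>z\<close> whose
    boundaries cancel.\<close>
  let ?z = "linear_extension (cone v) z - linear_extension (cone u) z"
  have "?z \<in> chains ?L (p + 1)"
    by (intro chain.subspace_diff[OF subspace_chains] cone_chain) auto
  moreover have "boundary ?z = 0"
    using boundary_linear_extension_cone[OF bz, of u] boundary_linear_extension_cone[OF bz, of v] sub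
    by (simp add: boundary_eq_linear_extension linear_extension_diff)
  ultimately have "?z \<in> cycles ?L (p + 1)"
    by (simp add: cycles_def)
  then obtain e where e: "e \<in> chains ?L (p + 1 + 1)" "?z = boundary e"
    using acyc by (auto simp: acyclic_at_def boundaries_def)
  \<comment> \<open>Contraction by \<open>v\<close> undoes the cone with apex \<open>v\<close> and
    kills the cone with apex \<open>u\<close>, whose faces avoid \<open>v\<close>.\<close>
  have "linear_extension (contract v) ?z = z"
  proof -
    have "linear_extension (contract v) (linear_extension (cone v) z) =
        linear_extension (\<lambda>S. Poly_Mapping.single S 1) z"
      unfolding linear_extension_comp using sub by (intro linear_extension_cong contract_cone) auto
    moreover have "linear_extension (contract v) (linear_extension (cone u) z) =
        linear_extension (\<lambda>S. 0) z"
      unfolding linear_extension_comp using sub assms(3)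
      by (intro linear_extension_cong contract_cone_other) auto
    ultimately show ?thesis
      by (simp add: linear_extension_diff linear_extension_ident) (simp add: linear_extension_def)
  qed
  then have "z = - boundary (linear_extension (contract v) e)"
    by (simp add: e(2) contract_boundary)
  then have z: "z = boundary (- linear_extension (contract v) e)"
    by (simp add: boundary_eq_linear_extension linear_extension_uminus)
  have "- linear_extension (contract v) e \<in> chains ?X (p + 1)"
    unfolding chains_def
  proof (intro CollectI ballI)
    fix T assume "T \<in> Poly_Mapping.keys (- linear_extension (contract v) e)"
    then have "T \<in> Poly_Mapping.keys (linear_extension (contract v) e)"
      by (simp add: in_keys_iff)
    then obtain S where S: "S \<in> Poly_Mapping.keys e" "v \<in> S" "T = S - {v}"
      by (rule keys_linear_extensionE) (auto simp: contract_def split: if_splits)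
    have SL: "S \<in> ?L" "int (card S) = p + 1 + 1 + 1"
      using S(1) e(1) by (auto simp: chains_def)
    have "x \<in> W" if "x \<in> T" for x
      using that SL(1) S(2,3) adj[of x] assms(2) by (auto simp: independence_complex_def)
    moreover have "finite S"
      using calculation assms(1) S(3) by (metis finite_Diff_insert finite.emptyI finite_subset subsetI Diff_empty)
    ultimately show "T \<in> ?X \<and> int (card T) = p + 1 + 1"
      using SL S(2,3) card_Suc_Diff1[of S v] by (auto simp: independence_complex_def)
  qed
  then show "z \<in> boundaries ?X p"
    unfolding boundaries_def using z by blast
qed

text \<open>The empty face is a nonzero cycle, and no face of dimension 0 exists to bound it. This
  yields the contradiction in \<open>degree_bound\<close>.\<close>

lemma not_acyclic_at_empty: "\<not> acyclic_at TYPE('k::field) (independence_complex {} E) (- 1)"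
proof
  assume acyc: "acyclic_at TYPE('k) (independence_complex {} E) (- 1)"
  let ?z = "Poly_Mapping.single {} 1 :: 'a set \<Rightarrow>\<^sub>0 'k"
  have "?z \<in> cycles (independence_complex {} E) (- 1)"
    by (simp add: cycles_def chains_def independence_complex_def boundary_single simplex_boundary_def)
  then obtain c where c: "c \<in> chains (independence_complex {} E) 0" "?z = boundary c"
    using acyc by (auto simp: acyclic_at_def boundaries_def)
  have "Poly_Mapping.keys c = {}"
    using c(1) by (force simp: chains_def independence_complex_def simp del: keys_eq_empty)
  then have "?z = 0"
    by (simp add: c(2) boundary_def)
  then show False
    by (metis lookup_single_eq lookup_zero one_neq_zero)
qed

section \<open>Colourings and cliques\<close>

lemma independence_complex_induced_edges:
  "independence_complex W (induced_edges E W) = independence_complex W E"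
  by (auto simp: independence_complex_def induced_edges_def)

section \<open>Building colourings\<close>

lemma proper_coloring_mono: "proper_coloring V E k c \<Longrightarrow> k \<le> l \<Longrightarrow> proper_coloring V E l c"
  by (fastforce simp: proper_coloring_def)

text \<open>The classes of \<open>f\<close> receive disjoint palettes: each new class uses the
  colours from \<open>sum s I\<close> upward.\<close>

lemma proper_coloring_sum:
  assumes "finite I" and "f ` V \<subseteq> I"
    and "\<And>i. i \<in> I \<Longrightarrow> \<exists>c. proper_coloring {x \<in> V. f x = i} E (s i) c"
  shows "\<exists>c. proper_coloring V E (sum s I) c"
  using assms
proof (induction I arbitrary: V)
  case empty
  then show ?case
    by (auto simp: proper_coloring_def)
next
  case (insert i I)
  obtain c where c: "proper_coloring {x \<in> V. f x = i} E (s i) c"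
    using insert.prems(2) by blast
  have "\<exists>c. proper_coloring {x \<in> {x \<in> V. f x \<noteq> i}. f x = j} E (s j) c" if "j \<in> I" for j
  proof -
    have "{x \<in> {x \<in> V. f x \<noteq> i}. f x = j} = {x \<in> V. f x = j}"
      using insert.hyps that by auto
    then show ?thesis
      using insert.prems(2) that by auto
  qed
  then obtain c' where c': "proper_coloring {x \<in> V. f x \<noteq> i} E (sum s I) c'"
    using insert.IH[of "{x \<in> V. f x \<noteq> i}"] insert.prems(1) by auto
  have "proper_coloring V E (sum s (insert i I)) (\<lambda>x. if f x = i then sum s I + c x else c' x)"
    unfolding proper_coloring_def
  proof (intro conjI ballI impI)
    fix x assume x: "x \<in> V"
    show "(if f x = i then sum s I + c x else c' x) < sum s (insert i I)"
    proof (cases "f x = i")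
      case True
      then show ?thesis
        using c x insert.hyps by (simp add: proper_coloring_def)
    next
      case False
      then have "c' x < sum s I"
        using c' x by (simp add: proper_coloring_def)
      then show ?thesis
        using False insert.hyps by simp
    qed
    fix y assume y: "y \<in> V" "{x, y} \<in> E"
    have "c' z < sum s I" if "z \<in> V" "f z \<noteq> i" for z
      using c' that by (simp add: proper_coloring_def)
    from this[of x] this[of y] show "(if f x = i then sum s I + c x else c' x) \<noteq> (if f y = i then sum s I + c y else c' y)"
      using c c' x y by (cases "f x = i"; cases "f y = i") (auto simp: proper_coloring_def dest: leD)
  qed
  then show ?case
    by blast
qed

text \<open>Fewer than \<open>k\<close> neighbours leave one of \<open>k\<close> colours free, and
  degrees do not grow when vertices are removed.\<close>

lemma proper_coloring_greedy:
  assumes "finite V" and loops: "\<And>x. {x} \<notin> E"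
    and "\<And>v. v \<in> V \<Longrightarrow> card {u \<in> V. {u, v} \<in> E} < k"
  shows "\<exists>c. proper_coloring V E k c"
  using assms(1,3)
proof (induction V)
  case empty
  then show ?case
    by (auto simp: proper_coloring_def)
next
  case (insert v V)
  have "card {u \<in> V. {u, w} \<in> E} < k" if "w \<in> V" for w
  proof -
    have "card {u \<in> V. {u, w} \<in> E} \<le> card {u \<in> insert v V. {u, w} \<in> E}"
      using insert.hyps by (intro card_mono) auto
    then show ?thesis
      using insert.prems[of w] that by simp
  qed
  then obtain c where c: "proper_coloring V E k c"
    using insert.IH by blast
  let ?N = "{u \<in> insert v V. {u, v} \<in> E}"
  have "card (c ` ?N) < k"
    using card_image_le[of ?N c] insert.prems[of v] insert.hyps by simp
  then have "\<not> {..<k} \<subseteq> c ` ?N"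
    using card_mono[of "c ` ?N" "{..<k}"] insert.hyps by auto
  then obtain m where m: "m < k" "m \<notin> c ` ?N"
    by auto
  have "proper_coloring (insert v V) E k (c(v := m))"
    using c m loops insert.hyps unfolding proper_coloring_def
    by (auto simp: insert_commute image_iff)
  then show ?case
    by blast
qed

section \<open>Cliques and the clique number\<close>

lemma finite_clique_cards:
  assumes "finite V"
  shows "finite {card C | C. clique V E C}"
proof -
  have "{card C | C. clique V E C} \<subseteq> card ` Pow V"
    by (auto simp: clique_def)
  then show ?thesis
    using assms by (meson finite_Pow_iff finite_imageI finite_subset)
qed

lemma card_le_clique_number:
  assumes "finite V" "clique V E C"
  shows "card C \<le> clique_number V E"
  unfolding clique_number_def using finite_clique_cards[OF assms(1)] assms(2) by (auto intro: Max_ge)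

lemma clique_subset: "clique V E C \<Longrightarrow> D \<subseteq> C \<Longrightarrow> clique V E D"
  by (auto simp: clique_def)

lemma clique_insert:
  assumes "clique V E C" "x \<in> V" "\<And>y. y \<in> C \<Longrightarrow> {x, y} \<in> E"
  shows "clique V E (insert x C)"
  using assms by (auto simp: clique_def insert_commute[of _ x "{}"])

lemma clique_Un:
  assumes "clique V E C" "clique V E D" "\<And>x y. x \<in> C \<Longrightarrow> y \<in> D \<Longrightarrow> {x, y} \<in> E"
  shows "clique V E (C \<union> D)"
  unfolding clique_def
proof (intro conjI ballI impI)
  show "C \<union> D \<subseteq> V"
    using assms(1,2) by (simp add: clique_def)
  fix x y assume "x \<in> C \<union> D" "y \<in> C \<union> D" "x \<noteq> y"
  then show "{x, y} \<in> E"
    using assms(1,2) assms(3)[of x y] assms(3)[of y x]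
    by (auto simp: clique_def insert_commute)
qed

lemma clique_number_attained:
  assumes "finite V"
  obtains C where "clique V E C" "card C = clique_number V E"
proof -
  have "clique V E {}"
    by (simp add: clique_def)
  then have "Max {card C | C. clique V E C} \<in> {card C | C. clique V E C}"
    by (intro Max_in finite_clique_cards assms) auto
  then show thesis
    using that by (auto simp: clique_number_def)
qed

lemma clique_number_pos:
  assumes "finite V" "V \<noteq> {}"
  shows "1 \<le> clique_number V E"
proof -
  obtain v where "v \<in> V"
    using assms(2) by auto
  then have "clique V E {v}"
    by (simp add: clique_def)
  then show ?thesis
    using card_le_clique_number[OF assms(1)] by fastforce
qed

lemma proper_coloring_edgeless:
  assumes "finite V" "\<And>x. {x} \<notin> E" "clique_number V E = 1"
  shows "\<exists>c. proper_coloring V E 1 c"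
proof -
  have "{u, v} \<notin> E" if "u \<in> V" "v \<in> V" for u v
  proof
    assume "{u, v} \<in> E"
    then have "u \<noteq> v"
      using assms(2) by auto
    moreover have "clique V E {u, v}"
      using that \<open>{u, v} \<in> E\<close> by (auto simp: clique_def insert_commute)
    ultimately show False
      using card_le_clique_number[OF assms(1), of E "{u, v}"] assms(3) by simp
  qed
  then show ?thesis
    by (auto simp: proper_coloring_def intro: exI[of _ "\<lambda>_. 0"])
qed

section \<open>The bounding function\<close>

lemma chi_bound_1: "chi_bound n d 1 = 1"
  by (cases d) simp_all

text \<open>At \<open>w = 1\<close> the sum is its single term 1, so the case distinction of
  \<open>chi_bound\<close> is absorbed.\<close>

lemma chi_bound_Suc_eq_sum:
  assumes "1 \<le> w"
  shows "chi_bound n (Suc d) w =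
    (\<Sum>k = 1..w. (int w - int k + 1) * chi_bound (max (n + int k - int w - 2) (2 * int (Suc d))) d k)"
  using assms chi_bound_1[of _ d] by simp

text \<open>Raising \<open>k\<close> and \<open>w\<close> together fixes
  \<open>n + k - w - 2\<close> and the factor \<open>w - k + 1\<close>, so summand \<open>k\<close>
  for \<open>w\<close> is compared with summand \<open>k + 1\<close> for \<open>w + 1\<close>; the
  summand 1 left over is nonnegative. Both claims go through one induction because comparing the
  products uses nonnegativity.\<close>

lemma chi_bound_nonneg_le_Suc:
  assumes "2 * (int d + 1) \<le> n" "1 \<le> w"
  shows "0 \<le> chi_bound n d w \<and> chi_bound n d w \<le> chi_bound n d (Suc w)"
  using assms
proof (induction d arbitrary: n w)
  case 0
  then show ?case
    by simp
next
  case (Suc d)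
  define g where "g w k = chi_bound (max (n + int k - int w - 2) (2 * int (Suc d))) d k" for w k
  have g: "0 \<le> g w k" "g w k \<le> g (Suc w) (Suc k)" if "1 \<le> k" for w k
  proof -
    let ?m = "max (n + int k - int w - 2) (2 * int (Suc d))"
    have "0 \<le> chi_bound ?m d k \<and> chi_bound ?m d k \<le> chi_bound ?m d (Suc k)"
      using that by (intro Suc.IH) auto
    moreover have "n + int (Suc k) - int (Suc w) - 2 = n + int k - int w - 2"
      by simp
    ultimately show "0 \<le> g w k" "g w k \<le> g (Suc w) (Suc k)"
      unfolding g_def by metis+
  qed
  have eq: "chi_bound n (Suc d) w = (\<Sum>k = 1..w. (int w - int k + 1) * g w k)" if "1 \<le> w" for w
    unfolding g_def using that by (rule chi_bound_Suc_eq_sum)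
  have nonneg: "0 \<le> (\<Sum>k = 1..w. (int w - int k + 1) * g w k)"
    by (intro sum_nonneg mult_nonneg_nonneg g) auto
  have "(\<Sum>k = 1..w. (int w - int k + 1) * g w k) \<le>
      (\<Sum>k = 1..w. (int (Suc w) - int (Suc k) + 1) * g (Suc w) (Suc k))"
    using g by (intro sum_mono mult_mono) auto
  also have "\<dots> = (\<Sum>k = Suc 1..Suc w. (int (Suc w) - int k + 1) * g (Suc w) k)"
    by (rule sum.shift_bounds_cl_Suc_ivl[symmetric])
  also have "\<dots> \<le> (\<Sum>k = 1..Suc w. (int (Suc w) - int k + 1) * g (Suc w) k)"
    using g(1) by (intro sum_mono2 mult_nonneg_nonneg) auto
  finally show ?case
    using nonneg eq[of w] eq[of "Suc w"] Suc.prems(2) by (simp only: le_SucI)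
qed

text \<open>Includes \<open>w = 0\<close>, the clique number of the empty graph.\<close>

lemma chi_bound_nonneg:
  assumes "2 * (int d + 1) \<le> n"
  shows "0 \<le> chi_bound n d w"
proof (cases "w = 0")
  case True
  then show ?thesis
    using assms by (cases d) auto
qed (use assms chi_bound_nonneg_le_Suc[of d n w] in simp)

lemma chi_bound_mono:
  assumes "2 * (int d + 1) \<le> n" "1 \<le> v" "v \<le> w"
  shows "chi_bound n d v \<le> chi_bound n d w"
  using assms(3)
proof (induction w rule: dec_induct)
  case (step w)
  then show ?case
    using chi_bound_nonneg_le_Suc[OF assms(1), of w] assms(2) by linarith
qed simp

section \<open>The colouring\<close>

text \<open>Neighbours of \<open>v\<close> from \<open>D\<close> fill
  \<open>W \<union> {u, v}\<close> up to exactly \<open>n\<close> vertices, and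
  \<open>acyclic_at_suspension\<close> applies. The two bounds in \<open>card\<close> say that the
  number of fillers lies between 0 and \<open>card D\<close>.\<close>

lemma acyclic_at_common_nonneighbours:
  assumes "finite V" and loops: "\<And>x. {x} \<notin> E"
    and "u \<in> V" "v \<in> V" "{u, v} \<in> E"
    and "W \<subseteq> V" "\<And>x. x \<in> W \<Longrightarrow> {x, u} \<notin> E \<and> {x, v} \<notin> E"
    and "D \<subseteq> V" "\<And>x. x \<in> D \<Longrightarrow> {x, v} \<in> E" "u \<notin> D"
    and card: "int (card W) + 2 \<le> n" "n \<le> int (card W) + 2 + int (card D)"
    and acyc: "\<And>U. U \<subseteq> V \<Longrightarrow> int (card U) = n \<Longrightarrow>
      acyclic_at TYPE('k::field) (independence_complex U E) (p + 1)"
  shows "acyclic_at TYPE('k) (independence_complex W E) p"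
proof -
  have "nat (n - 2 - int (card W)) \<le> card D"
    using card by simp
  then obtain C where C: "C \<subseteq> D" "card C = nat (n - 2 - int (card W))"
    by (metis obtain_subset_with_card_n)
  have notin: "u \<noteq> v" "u \<notin> W" "v \<notin> W" "u \<notin> C" "v \<notin> C" "W \<inter> C = {}"
    using assms(5,7,9,10) loops C(1) by (auto, (metis insert_absorb2 insert_commute subsetD)+)
  have fin: "finite W" "finite C"
    using assms(1,6,8) C(1) by (auto intro: finite_subset)
  have "int (card (W \<union> C \<union> {u, v})) = n"
    using fin notin C(2) card(1) by (simp add: card_Un_disjoint)
  moreover have "W \<union> C \<union> {u, v} \<subseteq> V"
    using assms C(1) by auto
  ultimately have "acyclic_at TYPE('k) (independence_complex (W \<union> C \<union> {u, v}) E) (p + 1)"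
    by (intro acyc)
  then show ?thesis
    using fin notin loops assms(5,7,9) C(1) by (intro acyclic_at_suspension[of W u v E C p]) auto
qed

text \<open>Given \<open>n - 1\<close> neighbours of \<open>v\<close>, take one as \<open>u\<close>,
  the others as fillers and \<open>W\<close> empty: the complex of the empty graph would be acyclic
  in degree -1.\<close>

lemma degree_bound:
  assumes "finite V" and loops: "\<And>x. {x} \<notin> E" and "v \<in> V" "2 \<le> n"
    and acyc: "\<And>U. U \<subseteq> V \<Longrightarrow> int (card U) = n \<Longrightarrow>
      acyclic_at TYPE('k::field) (independence_complex U E) 0"
  shows "int (card {u \<in> V. {u, v} \<in> E}) < n - 1"
proof (rule ccontr)
  let ?N = "{u \<in> V. {u, v} \<in> E}"
  assume "\<not> int (card ?N) < n - 1"
  then have card: "n - 1 \<le> int (card ?N)"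
    by simp
  then have "?N \<noteq> {}"
    using assms(4) by force
  then obtain u where u: "u \<in> ?N"
    by auto
  have "acyclic_at TYPE('k) (independence_complex {} E) (- 1)"
    using assms u card
    by (intro acyclic_at_common_nonneighbours[of V E u v "{}" "?N - {u}" n]) auto
  then show False
    by (simp add: not_acyclic_at_empty)
qed

text \<open>
  Number the vertices of a maximum clique from 1 to \<open>\<omega>\<close>. In the induction step a vertex whose first
  two nonneighbours in the clique are \<open>a < b\<close> is put in class \<open>(b, a)\<close>, and one with the single
  nonneighbour \<open>a\<close> in class \<open>(a, a)\<close>. The class \<open>(b, a)\<close> is completely joined to \<open>b - 2\<close> vertices of
  the clique, hence has clique number at most \<open>k = \<omega> + 2 - b\<close>. The \<open>b - 1 = \<omega> - k + 1\<close> classes with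
  this \<open>b\<close> give the summand \<open>k\<close> of \<open>chi_bound\<close>, and the classes \<open>(a, a)\<close> the summand 1.
\<close>

lemma proper_coloring_chi_bound:
  assumes "finite V" and loops: "\<And>x. {x} \<notin> E" and "2 * (int d + 1) \<le> n"
    and "\<And>U. U \<subseteq> V \<Longrightarrow> int (card U) = n \<Longrightarrow>
      acyclic_at TYPE('k::field) (independence_complex U E) (int d)"
  shows "\<exists>c. proper_coloring V E (nat (chi_bound n d (clique_number V E))) c"
  using assms(1,3,4)
proof (induction d arbitrary: V n)
  case 0
  show ?case
  proof (cases "clique_number V E = 1")
    case True
    then show ?thesis
      using proper_coloring_edgeless[OF 0(1) loops] by simp
  next
    case False
    have "card {u \<in> V. {u, v} \<in> E} < nat (n - 1)" if "v \<in> V" for v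
      using degree_bound[where 'k = 'k, OF 0(1) loops that, of n] 0 by simp
    then show ?thesis
      using proper_coloring_greedy[OF 0(1) loops] False by simp
  qed
next
  case (Suc d)
  define w where "w = clique_number V E"
  show ?case
  proof (cases "w = 0")
    case True
    then have "V = {}"
      using clique_number_pos[OF Suc.prems(1), of E] by (auto simp: w_def)
    then show ?thesis
      by (simp add: proper_coloring_def)
  next
    case False
    obtain K where K: "clique V E K" "card K = w"
      using clique_number_attained[OF Suc.prems(1)] unfolding w_def by blast
    then have "finite K"
      using False card.infinite by fastforce
    then obtain h where h: "bij_betw h {1..w} K"
      using K(2) ex_bij_betw_nat_finite_1 by blast
    have hK: "h c \<in> K" "h c \<in> V" if "c \<in> {1..w}" for c
      using bij_betw_apply[OF h that] K(1) by (auto simp: clique_def)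
    have hadj: "{h a, h b} \<in> E" if "a \<in> {1..w}" "b \<in> {1..w}" "a \<noteq> b" for a b
    proof -
      have "h a \<noteq> h b"
        using bij_betw_imp_inj_on[OF h] that by (meson inj_onD)
      then show ?thesis
        using K(1) hK(1) that by (simp add: clique_def)
    qed
    have hcard: "card (h ` A) = card A" if "A \<subseteq> {1..w}" for A
      using h that by (meson bij_betw_def card_image inj_on_subset)
    have max: "card C \<le> w" if "clique V E C" for C
      using card_le_clique_number[OF Suc.prems(1) that] by (simp add: w_def)

    \<comment> \<open>The case \<open>a = b\<close> encodes a single nonneighbour. Without loops
      \<open>h a\<close> is a nonneighbour of itself, so it falls in class
      \<open>(a, a)\<close>.\<close>
    define first_two where "first_two x b a \<longleftrightarrow> a \<in> {1..w} \<and> b \<in> {1..w} \<and> a \<le> b \<and>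
      {x, h a} \<notin> E \<and> {x, h b} \<notin> E \<and> (\<forall>c\<in>{1..<b}. c \<noteq> a \<longrightarrow> {x, h c} \<in> E) \<and>
      (a = b \<longrightarrow> (\<forall>c\<in>{1..w}. c \<noteq> a \<longrightarrow> {x, h c} \<in> E))" for x b a
    have "\<exists>p. first_two x (fst p) (snd p)" if "x \<in> V" for x
    proof -
      define N where "N = {c \<in> {1..w}. {x, h c} \<notin> E}"
      \<comment> \<open>Otherwise \<open>x\<close> would extend the maximum clique.\<close>
      have "N \<noteq> {}"
      proof
        assume "N = {}"
        then have adj: "{x, h c} \<in> E" if "c \<in> {1..w}" for c
          using that by (auto simp: N_def)
        have adjK: "{x, y} \<in> E" if "y \<in> K" for y
          using adj h that by (force simp: bij_betw_def)
        then have "x \<notin> K"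
          using loops by (metis insert_absorb2)
        moreover have "clique V E (insert x K)"
          using adjK K(1) \<open>x \<in> V\<close> by (intro clique_insert)
        ultimately show False
          using max[of "insert x K"] K(2) \<open>finite K\<close> by simp
      qed
      moreover have "finite N"
        by (simp add: N_def)
      ultimately have a: "Min N \<in> N" "\<And>c. c \<in> N \<Longrightarrow> Min N \<le> c"
        by auto
      show ?thesis
      proof (cases "N = {Min N}")
        case True
        have "first_two x (Min N) (Min N)"
          using a True unfolding first_two_def N_def by fastforce
        then show ?thesis
          by (metis fst_conv snd_conv)
      next
        case False
        define b where "b = Min (N - {Min N})"
        have ne: "N - {Min N} \<noteq> {}"
          using False a(1) by auto
        then have b: "b \<in> N - {Min N}"
          unfolding b_def using \<open>finite N\<close> by (intro Min_in) auto
        have b_le: "b \<le> c" if "c \<in> N" "c \<noteq> Min N" for c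
          unfolding b_def using \<open>finite N\<close> that by (intro Min_le) auto
        have "{x, h c} \<in> E" if "c \<in> {1..<b}" "c \<noteq> Min N" for c
          using b_le[of c] that b by (auto simp: N_def)
        then have "first_two x b (Min N)"
          using a b unfolding first_two_def N_def by auto
        then show ?thesis
          by (metis fst_conv snd_conv)
      qed
    qed
    then obtain f where f: "\<And>x. x \<in> V \<Longrightarrow> first_two x (fst (f x)) (snd (f x))"
      by metis

    \<comment> \<open>Of \<open>n\<close> vertices, 2 go to \<open>h a\<close> and
      \<open>h b\<close>, and up to \<open>b - 2\<close> to clique vertices as fillers. With
      \<open>k = w + 2 - b\<close>, \<open>n - b\<close> is the \<open>n + k - w - 2\<close> of
      \<open>chi_bound\<close>; the maximum keeps the induction hypothesis applicable.\<close>
    define m where "m b = max (n - int b) (2 * int (Suc d))" for b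
    define s where "s = (\<lambda>(b, a). if a = b then 1 else nat (chi_bound (m b) d (w + 2 - b)))"
    have part: "\<exists>c. proper_coloring {x \<in> V. f x = (b, a)} E (s (b, a)) c"
      if ab: "b \<in> {1..w}" "a \<in> {1..b}" for a b
    proof -
      define A where "A = {x \<in> V. f x = (b, a)}"
      have A: "first_two x b a" if "x \<in> A" for x
        using f[of x] that by (auto simp: A_def)
      have "A \<subseteq> V"
        by (auto simp: A_def)
      then have "finite A"
        using Suc.prems(1) finite_subset by blast
      have "\<exists>c. proper_coloring A E (s (b, a)) c"
      proof (cases "a = b")
        case True
        \<comment> \<open>An edge inside the class could replace \<open>h a\<close> in the clique,
          giving size \<open>w + 1\<close>.\<close>
        have "{x, y} \<notin> E" if "x \<in> A" "y \<in> A" for x y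
        proof
          assume xy: "{x, y} \<in> E"
          let ?C = "insert x (insert y (h ` ({1..w} - {a})))"
          have adj: "{x, z} \<in> E" "{y, z} \<in> E" if "z \<in> h ` ({1..w} - {a})" for z
            using A[OF \<open>x \<in> A\<close>] A[OF \<open>y \<in> A\<close>] that True by (auto simp: first_two_def)
          have "x \<noteq> y" "x \<notin> h ` ({1..w} - {a})" "y \<notin> h ` ({1..w} - {a})"
            using xy adj[of x] adj[of y] loops by auto
          then have "card ?C = Suc (Suc (card (h ` ({1..w} - {a}))))"
            by simp
          also have "\<dots> = Suc w"
            using hcard[of "{1..w} - {a}"] ab by simp
          finally have "card ?C = Suc w" .
          moreover have "clique V E ?C"
            using that \<open>A \<subseteq> V\<close> adj xy hK(1)
            by (intro clique_insert clique_subset[OF K(1)]) blast+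
          ultimately show False
            using max[of ?C] by simp
        qed
        then show ?thesis
          using True by (auto simp: s_def proper_coloring_def intro: exI[of _ "\<lambda>_. 0"])
      next
        case False
        let ?D = "h ` ({1..<b} - {a})"
        have cardD: "card ?D = b - 2"
        proof -
          have "{1..<b} - {a} \<subseteq> {1..w}"
            using ab by auto
          then show ?thesis
            using hcard ab False by simp
        qed
        have adjD: "{x, y} \<in> E" if "x \<in> A" "y \<in> ?D" for x y
          using A[OF that(1)] that(2) by (auto simp: first_two_def)
        have m: "2 * (int d + 1) \<le> m b"
          by (simp add: m_def)
        have edge: "{h a, h b} \<in> E"
          using hadj[of a b] ab False by simp
        have "acyclic_at TYPE('k) (independence_complex U E) (int d)"
          if U: "U \<subseteq> A" "int (card U) = m b" for U
        \<comment> \<open>Here \<open>h a\<close> acts as \<open>u\<close>, \<open>h b\<close> as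
          \<open>v\<close>, and the clique vertices in \<open>?D\<close> are the fillers.\<close>
        proof (rule acyclic_at_common_nonneighbours[OF Suc.prems(1) loops _ _ edge])
          show "h a \<in> V" "h b \<in> V"
            using hK ab by auto
          show "U \<subseteq> V" "?D \<subseteq> V"
            using U(1) \<open>A \<subseteq> V\<close> hK ab by auto
          show "{x, h a} \<notin> E \<and> {x, h b} \<notin> E" if "x \<in> U" for x
            using A[of x] U(1) that by (auto simp: first_two_def)
          show "{x, h b} \<in> E" if "x \<in> ?D" for x
            using that hadj[of _ b] ab by auto
          show "h a \<notin> ?D"
          proof
            assume "h a \<in> ?D"
            then obtain c where "c \<in> {1..<b} - {a}" "h a = h c"
              by blast
            then show False
              using hadj[of a c] loops ab by auto
          qed
          show "int (card U) + 2 \<le> n" "n \<le> int (card U) + 2 + int (card ?D)"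
            using U(2) cardD Suc.prems(2) ab False by (auto simp: m_def)
          show "acyclic_at TYPE('k) (independence_complex U' E) (int d + 1)"
            if "U' \<subseteq> V" "int (card U') = n" for U'
            using Suc.prems(3)[OF that] by (simp add: add.commute)
        qed
        then obtain c where c: "proper_coloring A E (nat (chi_bound (m b) d (clique_number A E))) c"
          using Suc.IH[OF \<open>finite A\<close> m] by blast
        \<comment> \<open>An empty class has clique number 0, while \<open>chi_bound_mono\<close>
          starts at 1; on it every colouring is proper.\<close>
        have "nat (chi_bound (m b) d (clique_number A E)) \<le> s (b, a)" if "A \<noteq> {}"
        proof -
          obtain Q where Q: "clique A E Q" "card Q = clique_number A E"
            using clique_number_attained[OF \<open>finite A\<close>] by blast
          have "Q \<subseteq> A"
            using Q(1) by (simp add: clique_def)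
          have "x \<notin> ?D" if "x \<in> Q" for x
            using adjD[of x x] loops[of x] that \<open>Q \<subseteq> A\<close> by (metis insert_absorb2 subsetD)
          then have disj: "Q \<inter> ?D = {}"
            by blast
          have "clique V E Q"
            using Q(1) \<open>A \<subseteq> V\<close> by (auto simp: clique_def)
          moreover have "clique V E ?D"
            using hK(1) ab by (intro clique_subset[OF K(1)]) auto
          ultimately have "clique V E (Q \<union> ?D)"
            using adjD \<open>Q \<subseteq> A\<close> by (intro clique_Un) blast+
          then have "card (Q \<union> ?D) \<le> w"
            by (rule max)
          moreover have "card (Q \<union> ?D) = card Q + card ?D"
            using \<open>Q \<subseteq> A\<close> \<open>finite A\<close> disj by (intro card_Un_disjoint) (auto intro: finite_subset)
          ultimately have "clique_number A E \<le> w + 2 - b"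
            using cardD Q(2) ab by simp
          then have "chi_bound (m b) d (clique_number A E) \<le> chi_bound (m b) d (w + 2 - b)"
            using clique_number_pos[OF \<open>finite A\<close> that] m by (intro chi_bound_mono)
          then show ?thesis
            using False by (simp add: s_def)
        qed
        then have "proper_coloring A E (s (b, a)) c"
          using proper_coloring_mono[OF c] by (cases "A = {}") (simp_all add: proper_coloring_def)
        then show ?thesis
          by blast
      qed
      then show ?thesis
        by (simp add: A_def)
    qed

    let ?I = "Sigma {1..w} (\<lambda>b. {1..b})"
    have "\<exists>c. proper_coloring V E (sum s ?I) c"
    proof (rule proper_coloring_sum[where f = f])
      show "f ` V \<subseteq> ?I"
      proof
        fix p assume "p \<in> f ` V"
        then obtain x where "x \<in> V" "p = f x"
          by blast
        then show "p \<in> ?I"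
          using f[of x] by (cases "f x") (simp add: first_two_def)
      qed
    qed (use part in auto)
    moreover have "int (sum s ?I) = chi_bound n (Suc d) w"
    proof -
      have m: "0 \<le> chi_bound (m b) d k" for b k
        by (rule chi_bound_nonneg) (simp add: m_def)
      define g where "g b = chi_bound (m b) d (w + 2 - b)" for b
      \<comment> \<open>One colour for class \<open>(b, b)\<close> and \<open>g b\<close> for each
        of the \<open>b - 1\<close> classes with \<open>a < b\<close>.\<close>
      have inner: "int (\<Sum>a = 1..b. s (b, a)) = 1 + (int b - 1) * g b" if "b \<in> {1..w}" for b
      proof -
        have "(\<Sum>a = 1..b. s (b, a)) = s (b, b) + (\<Sum>a \<in> {1..b} - {b}. s (b, a))"
          using that by (intro sum.remove) auto
        also have "\<dots> = 1 + (\<Sum>a \<in> {1..b} - {b}. nat (g b))"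
          by (auto simp: s_def g_def intro!: sum.cong)
        finally show ?thesis
          using that m by (simp add: g_def of_nat_diff)
      qed
      have "int (sum s ?I) = int (\<Sum>b = 1..w. \<Sum>a = 1..b. s (b, a))"
        by (subst sum.Sigma) (auto simp: case_prod_unfold)
      also have "\<dots> = (\<Sum>b = 1..w. int (\<Sum>a = 1..b. s (b, a)))"
        by (rule of_nat_sum)
      also have "\<dots> = (\<Sum>b = 1..w. 1 + (int b - 1) * g b)"
        by (rule sum.cong[OF refl inner])
      also have "\<dots> = int w + (\<Sum>b = 1..w. (int b - 1) * g b)"
        by (simp add: sum.distrib)
      \<comment> \<open>The term \<open>b = 1\<close> has factor 0.\<close>
      also have "(\<Sum>b = 1..w. (int b - 1) * g b) = (\<Sum>b = Suc 1..w. (int b - 1) * g b)"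
        using False by (subst sum.atLeast_Suc_atMost) auto
      \<comment> \<open>The substitution \<open>k = w + 2 - b\<close> reverses the range from 2 to
        \<open>w\<close>.\<close>
      also have "\<dots> = (\<Sum>k = Suc 1..w. (int w - int k + 1) *
          chi_bound (max (n + int k - int w - 2) (2 * int (Suc d))) d k)"
        by (rule sum.reindex_bij_witness[of _ "\<lambda>k. w + 2 - k" "\<lambda>k. w + 2 - k"])
           (auto simp: g_def m_def of_nat_diff algebra_simps)
      \<comment> \<open>The \<open>w\<close> colours of the classes \<open>(b, b)\<close> are the
        summand \<open>k = 1\<close>, since \<open>chi_bound\<close> is 1 there.\<close>
      also have "int w + \<dots> = chi_bound n (Suc d) w"
        using False chi_bound_1
        by (subst chi_bound_Suc_eq_sum) (simp_all add: sum.atLeast_Suc_atMost)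
      finally show ?thesis .
    qed
    ultimately show ?thesis
      unfolding w_def by (metis nat_int)
  qed
qed

text \<open>A vanishing sum of naturals has only zero summands, so all induced subgraphs on
  \<open>j\<close> vertices are acyclic in degree \<open>d = j - i - 2\<close>. Here
  \<open>i + 2 \<le> j\<close> says that \<open>d\<close> is nonnegative, and
  \<open>j \<le> 2 * i + 2\<close> that \<open>2 * (d + 1) \<le> j\<close>.\<close>

theorem mainTheorem6:
  fixes V :: "'a set" and E :: "'a set set" and i j :: int
  assumes "simple_graph V E"
    and "i + 2 \<le> j" and "j \<le> 2 * i + 2"
    and "edge_ideal_betti TYPE('k::field) V E i j = 0"
  shows "int (chromatic_number V E) \<le> chi_bound j (nat (j - i - 2)) (clique_number V E)"
proof -
  let ?d = "nat (j - i - 2)"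
  have fin: "finite V" and loops: "{x} \<notin> E" for x
    using assms(1) by (auto simp: simple_graph_def)
  have j: "2 * (int ?d + 1) \<le> j"
    using assms(2,3) by simp
  have "acyclic_at TYPE('k) (independence_complex W E) (int ?d)"
    if W: "W \<subseteq> V" "int (card W) = j" for W
  proof (rule acyclic_at_if_reduced_homology_dim_eq_0)
    have "finite W"
      using W(1) fin by (rule finite_subset)
    then show "finite (independence_complex W E)"
      by (auto simp: independence_complex_def)
    show "T \<in> independence_complex W E" if "S \<in> independence_complex W E" "T \<subseteq> S" for S T
      using that by (auto simp: independence_complex_def)
    have "finite {W. W \<subseteq> V \<and> int (card W) = j}"
      using fin by auto
    then show "reduced_homology_dim TYPE('k) (independence_complex W E) (int ?d) = 0"
      using assms(2,4) W by (auto simp: edge_ideal_betti_def independence_complex_induced_edges)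
  qed
  then obtain c where "proper_coloring V E (nat (chi_bound j ?d (clique_number V E))) c"
    using proper_coloring_chi_bound[where 'k = 'k, OF fin loops j] by blast
  then have "chromatic_number V E \<le> nat (chi_bound j ?d (clique_number V E))"
    unfolding chromatic_number_def by (intro Least_le exI)
  then show ?thesis
    using chi_bound_nonneg[OF j, of "clique_number V E"] by (simp add: le_nat_iff)
qed

end
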